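(* Let $1\le \ell\le d$ be integers and let $(\mathbf{P}_k)_{k\ge 0}$ be i.i.d. random matrices in $\mathbb{R}^{d\times \ell}$ such that $\mathbb{E}\,\mathbf{P}_k\mathbf{P}_k^\top=\mathbf{I}_d$ and $\mathbf{P}_k^\top\mathbf{P}_k=(d/\ell)\,\mathbf{I}_\ell$. Let $f:\mathbb{R}^d\to\mathbb{R}$ be continuously differentiable with $\lambda$-Lipschitz gradient ($\lambda>0$) and suppose $f$ attains its minimum $f_*$. Let $\mathbf{x}_0\in\mathbb{R}^d$ be an arbitrary (deterministic) initialization and, for $\alpha>0$, define $$\mathbf{x}_{k+1}=\mathbf{x}_k-\alpha\,\mathbf{P}_k\mathbf{P}_k^\top\nabla f(\mathbf{x}_k),\qquad k\ge 0.$$ (i) If $f$ is $\gamma$-strongly convex on $\mathbb{R}^d$ for some $\gamma>0$ and $0<\alpha<2\ell/(d\lambda)$, then $\mathbf{x}_k\to\mathbf{x}_*$ almost surely, where $\mathbf{x}_*$ is the unique minimizer of $f$. (ii) Suppose that either $f$ satisfies, for some $0<\gamma\le\lambda$, the Polyak-Lojasiewicz inequality $f(\mathbf{x})-f_*\le\|\nabla f(\mathbf{x})\|^2/(2\gamma)$ for all $\mathbf{x}\in\mathbb{R}^d$, or $f$ is $\gamma$-strongly convex on $\mathbb{R}^d$ for some $\gamma>0$. Then with $\alpha=\ell/(d\lambda)$, for every $k\ge 0$, $$\mathbb{E} f(\mathbf{x}_k)-f_*\le \omega^k\,(f(\mathbf{x}_0)-f_* ),\qquad \omega=1-\frac{\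ell\gamma}{d\lambda}.$$
   Context: $\|\cdot\|$ is the Euclidean norm on $\mathbb{R}^d$, and $\mathbf{I}_n$ is the $n\times n$ identity matrix. A differentiable function $f$ is $\gamma$-strongly convex if $f(\mathbf{y})\ge f(\mathbf{x})+\nabla f(\mathbf{x})^\top(\mathbf{y}-\mathbf{x})+\frac{\gamma}{2}\|\mathbf{y}-\mathbf{x}\|^2$ for all $\mathbf{x},\mathbf{y}\in\mathbb{R}^d$ (necessarily $\gamma\le\lambda$). *)

theory Defs
  imports "HOL-Probability.Probability"
begin

definition gradient :: "('a::euclidean_space \<Rightarrow> real) \<Rightarrow> 'a \<Rightarrow> 'a" where
  "gradient f x = (THE D. GDERIV f x :> D)"

lemma GDERIV_unique:
  fixes f :: "'a::euclidean_space \<Rightarrow> real"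
  assumes "GDERIV f x :> D" "GDERIV f x :> E"
  shows "D = E"
proof -
  have "(\<lambda>h. h \<bullet> D) = (\<lambda>h. h \<bullet> E)"
    using assms unfolding gderiv_def by (rule has_derivative_unique)
  then have "D \<bullet> b = E \<bullet> b" for b
    by (metis inner_commute)
  then show ?thesis
    by (simp add: euclidean_eq_iff[where 'a='a])
qed

lemma gradient_eqI:
  fixes f :: "'a::euclidean_space \<Rightarrow> real"
  shows "GDERIV f x :> D \<Longrightarrow> gradient f x = D"
  unfolding gradient_def by (blast intro: the_equality GDERIV_unique)

lemma GDERIV_gradient:
  fixes f :: "'a::euclidean_space \<Rightarrow> real"
  assumes "f differentiable (at x)"
  shows "GDERIV f x :> gradient f x"
proof -
  from assms obtain F where F: "(f has_derivative F) (at x)"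
    by (auto simp: differentiable_def)
  then interpret F: bounded_linear F
    by (rule has_derivative_bounded_linear)
  have "F = (\<lambda>h. h \<bullet> (\<Sum>b\<in>Basis. F b *\<^sub>R b))"
  proof
    fix h
    have "F h = F (\<Sum>b\<in>Basis. (h \<bullet> b) *\<^sub>R b)"
      by (simp add: euclidean_representation)
    also have "\<dots> = h \<bullet> (\<Sum>b\<in>Basis. F b *\<^sub>R b)"
      by (simp add: F.sum F.scaleR inner_sum_right mult.commute)
    finally show "F h = h \<bullet> (\<Sum>b\<in>Basis. F b *\<^sub>R b)" .
  qed
  with F have "GDERIV f x :> (\<Sum>b\<in>Basis. F b *\<^sub>R b)"
    unfolding gderiv_def by simp
  with gradient_eqI[OF this] show ?thesis by simp
qed

definition strongly_convex :: "real \<Rightarrow> ('a::euclidean_space \<Rightarrow> real) \<Rightarrow> bool" where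
  "strongly_convex \<gamma> f \<longleftrightarrow>
     (\<forall>x. f differentiable (at x)) \<and>
     (\<forall>x y. f y \<ge> f x + gradient f x \<bullet> (y - x) + \<gamma> / 2 * (norm (y - x))\<^sup>2)"

definition polyak_lojasiewicz ::
  "real \<Rightarrow> ('a::euclidean_space \<Rightarrow> real) \<Rightarrow> real \<Rightarrow> bool" where
  "polyak_lojasiewicz \<gamma> f fmin \<longleftrightarrow>
     (\<forall>x. f x - fmin \<le> (norm (gradient f x))\<^sup>2 / (2 * \<gamma>))"

text \<open>Iterates along one realisation \<open>P\<close> of the sequence of random matrices.\<close>

primrec subspace_descent ::
  "(real ^ 'd \<Rightarrow> real) \<Rightarrow> real \<Rightarrow> (nat \<Rightarrow> real ^ 'l ^ 'd) \<Rightarrow> real ^ 'd \<Rightarrow> nat \<Rightarrow> real ^ 'd" where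
  "subspace_descent f \<alpha> P x0 0 = x0"
| "subspace_descent f \<alpha> P x0 (Suc k) =
     subspace_descent f \<alpha> P x0 k -
     \<alpha> *\<^sub>R ((P k ** transpose (P k)) *v gradient f (subspace_descent f \<alpha> P x0 k))"

end

theory Submission
  imports Defs
begin

text \<open>
  Put A = P P^T and c = d/l. Almost surely A is symmetric with A A = c A, so that
  |A g|^2 = c (g . A g), and the quadratic upper bound for a function with Lipschitz gradient
  shows that a step with gradient g decreases f by at least eta (g . A g), where
  eta = alpha (1 - alpha lambda c / 2) > 0. Since the current iterate is independent of the current
  matrix and E A = I, the expected decrease is at least eta E |g|^2. Together with the
  Polyak-Lojasiewicz inequality this gives the linear rate; telescoping it gives that the sum of the
  E |g|^2 is finite, so the gradients tend to 0 almost surely, and strong convexity turns this into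
  convergence of the iterates.
\<close>

section \<open>Smooth and strongly convex functions\<close>

text \<open>Along the segment from \<open>x\<close> to \<open>x + v\<close>, the difference
  \<open>\<phi>\<close> between \<open>f\<close> and its quadratic model has a nonpositive
  derivative, by Cauchy-Schwarz and the Lipschitz condition. Comparing the endpoints needs no
  integral of the gradient.\<close>

lemma smooth_upper_bound:
  fixes f :: "'a::euclidean_space \<Rightarrow> real"
  assumes diff: "\<And>x. f differentiable (at x)"
    and lips: "L-lipschitz_on UNIV (gradient f)"
  shows "f (x + v) \<le> f x + gradient f x \<bullet> v + L / 2 * (norm v)\<^sup>2"
proof -
  define \<phi> where
    "\<phi> t = f (x + t *\<^sub>R v) - t * (gradient f x \<bullet> v) - L / 2 * (norm v)\<^sup>2 * t\<^sup>2" for t :: real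
  have D: "(\<phi> has_real_derivative
      (gradient f (x + t *\<^sub>R v) - gradient f x) \<bullet> v - L * (norm v)\<^sup>2 * t) (at t)" for t
  proof -
    have f: "(f has_derivative (\<lambda>h. h \<bullet> gradient f (x + t *\<^sub>R v))) (at (x + t *\<^sub>R v))"
      using GDERIV_gradient[OF diff] unfolding gderiv_def .
    have "((\<lambda>t. x + t *\<^sub>R v) has_derivative (\<lambda>h. h *\<^sub>R v)) (at t)"
      by (auto intro!: derivative_eq_intros)
    from has_derivative_compose[OF this f]
    have "((\<lambda>t. f (x + t *\<^sub>R v)) has_derivative (\<lambda>h. (h *\<^sub>R v) \<bullet> gradient f (x + t *\<^sub>R v))) (at t)" .
    then have "((\<lambda>t. f (x + t *\<^sub>R v)) has_real_derivative (gradient f (x + t *\<^sub>R v) \<bullet> v)) (at t)"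
      by (simp add: has_field_derivative_def inner_commute mult.commute[of _ "_ \<bullet> _"])
    then show ?thesis
      unfolding \<phi>_def by (auto intro!: derivative_eq_intros simp: inner_diff_left)
  qed
  have "\<phi> 1 \<le> \<phi> 0"
  proof (rule DERIV_nonpos_imp_nonincreasing[of 0 1 \<phi>])
    fix t :: real assume t: "0 \<le> t" "t \<le> 1"
    have "(gradient f (x + t *\<^sub>R v) - gradient f x) \<bullet> v
        \<le> norm (gradient f (x + t *\<^sub>R v) - gradient f x) * norm v"
      by (rule norm_cauchy_schwarz)
    also have "\<dots> \<le> (L * norm (t *\<^sub>R v)) * norm v"
      using lipschitz_onD[OF lips, of "x + t *\<^sub>R v" x]
      by (intro mult_right_mono) (auto simp: dist_norm)
    also have "\<dots> = L * (norm v)\<^sup>2 * t"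
      using t by (simp add: power2_eq_square)
    finally show "\<exists>y. (\<phi> has_real_derivative y) (at t) \<and> y \<le> 0"
      using D[of t] by (intro exI conjI) auto
  qed simp
  then show ?thesis by (simp add: \<phi>_def)
qed

text \<open>One gradient step cannot go below \<open>m\<close>. The bound makes gradients vanish at
  minimizers and lets function values dominate squared gradient norms.\<close>

lemma norm_gradient_le:
  fixes f :: "'a::euclidean_space \<Rightarrow> real"
  assumes "\<And>x. f differentiable (at x)"
    and "L-lipschitz_on UNIV (gradient f)" and "L > 0"
    and "\<And>x. m \<le> f x"
  shows "(norm (gradient f x))\<^sup>2 \<le> 2 * L * (f x - m)"
proof -
  \<comment> \<open>The step length \<open>1 / L\<close> minimizes the quadratic upper bound along
    the negative gradient.\<close>
  have "m \<le> f (x + (- (1 / L)) *\<^sub>R gradient f x)" by fact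
  also have "\<dots> \<le> f x - (norm (gradient f x))\<^sup>2 / (2 * L)"
    using smooth_upper_bound[OF assms(1,2), of x "(- (1 / L)) *\<^sub>R gradient f x"] \<open>L > 0\<close>
    by (simp add: dot_square_norm power_divide field_simps power2_eq_square)
  finally show ?thesis using \<open>L > 0\<close> by (simp add: field_simps)
qed

text \<open>The strong convexity lower bound, minimized over its second argument, equals
  \<open>f x\<close> minus the squared gradient norm over \<open>2 * \<gamma>\<close>; the minimum
  value \<open>m\<close> is no smaller.\<close>

lemma strongly_convex_imp_polyak_lojasiewicz:
  fixes f :: "'a::euclidean_space \<Rightarrow> real"
  assumes sc: "strongly_convex \<gamma> f" and "\<gamma> > 0" and "m \<in> range f"
  shows "polyak_lojasiewicz \<gamma> f m"
  unfolding polyak_lojasiewicz_def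
proof
  fix x
  obtain y where y: "m = f y" using \<open>m \<in> range f\<close> by auto
  define g where "g = gradient f x"
  \<comment> \<open>Completing the square: the minimizer of the lower bound is the point where this
    norm vanishes.\<close>
  have "0 \<le> (norm (g + \<gamma> *\<^sub>R (y - x)))\<^sup>2" by simp
  also have "\<dots> = (norm g)\<^sup>2 + 2 * \<gamma> * (g \<bullet> (y - x)) + \<gamma>\<^sup>2 * (norm (y - x))\<^sup>2"
    unfolding power2_norm_eq_inner
    by (simp add: inner_add_left inner_add_right inner_commute power2_eq_square algebra_simps)
  also have "\<dots> = 2 * \<gamma> * (g \<bullet> (y - x) + \<gamma> / 2 * (norm (y - x))\<^sup>2) + (norm g)\<^sup>2"
    by (simp add: power2_eq_square algebra_simps)
  also have "\<dots> \<le> 2 * \<gamma> * (m - f x) + (norm g)\<^sup>2"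
  proof -
    have "f x + g \<bullet> (y - x) + \<gamma> / 2 * (norm (y - x))\<^sup>2 \<le> m"
      using sc unfolding strongly_convex_def y g_def by blast
    then show ?thesis using \<open>\<gamma> > 0\<close> by (intro add_right_mono mult_left_mono) auto
  qed
  finally show "f x - m \<le> (norm (gradient f x))\<^sup>2 / (2 * \<gamma>)"
    using \<open>\<gamma> > 0\<close> by (simp add: field_simps g_def)
qed

lemma strongly_convex_growth:
  fixes f :: "'a::euclidean_space \<Rightarrow> real"
  assumes "strongly_convex \<gamma> f" and "gradient f z = 0"
  shows "\<gamma> / 2 * (norm (x - z))\<^sup>2 \<le> f x - f z"
  using assms unfolding strongly_convex_def by (metis add_diff_cancel_left'
      inner_zero_left add.right_neutral diff_right_mono)

section \<open>Algebra of a single sketched step\<close>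

lemma inner_matrix_vector_mult_left:
  fixes p :: "real ^ 'l ^ 'd"
  shows "(p *v a) \<bullet> b = a \<bullet> (transpose p *v b)"
  by (metis dot_lmul_matrix inner_commute transpose_matrix_vector)

lemma sketch_quadratic:
  fixes p :: "real ^ 'l ^ 'd"
  shows "g \<bullet> ((p ** transpose p) *v g) = (norm (transpose p *v g))\<^sup>2"
proof -
  have "g \<bullet> ((p ** transpose p) *v g) = (p *v (transpose p *v g)) \<bullet> g"
    by (simp only: matrix_vector_mul_assoc inner_commute)
  then show ?thesis
    by (simp only: inner_matrix_vector_mult_left power2_norm_eq_inner)
qed

text \<open>The matrix \<open>p ** transpose p\<close> is symmetric and its square is
  \<open>c\<close> times itself, so the squared norm collapses to the quadratic form.\<close>

lemma norm_sketch_mult: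
  fixes p :: "real ^ 'l ^ 'd" and g :: "real ^ 'd"
  assumes "transpose p ** p = c *\<^sub>R mat 1"
  shows "(norm ((p ** transpose p) *v g))\<^sup>2 = c * (g \<bullet> ((p ** transpose p) *v g))"
proof -
  let ?u = "transpose p *v g"
  have "(norm ((p ** transpose p) *v g))\<^sup>2 = (p *v ?u) \<bullet> (p *v ?u)"
    by (simp only: power2_norm_eq_inner matrix_vector_mul_assoc)
  also have "\<dots> = ?u \<bullet> ((transpose p ** p) *v ?u)"
    unfolding inner_matrix_vector_mult_left[of p ?u] by (simp only: matrix_vector_mul_assoc matrix_mul_assoc)
  also have "\<dots> = c * (?u \<bullet> ?u)"
    unfolding assms scaleR_matrix_vector_assoc[symmetric] matrix_vector_mul_lid inner_scaleR_right ..
  finally show ?thesis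
    by (simp only: sketch_quadratic power2_norm_eq_inner)
qed

text \<open>By \<open>norm_sketch_mult\<close>, the first-order and second-order terms of the upper
  bound are multiples of the same quadratic form and merge into one coefficient.\<close>

lemma sketched_step_le:
  fixes f :: "real ^ 'd \<Rightarrow> real" and p :: "real ^ 'l ^ 'd"
  assumes "\<And>x. f differentiable (at x)"
    and "L-lipschitz_on UNIV (gradient f)"
    and "transpose p ** p = c *\<^sub>R mat 1"
  defines "s \<equiv> \<lambda>x. (p ** transpose p) *v gradient f x"
  shows "f (x - \<alpha> *\<^sub>R s x) \<le> f x - \<alpha> * (1 - \<alpha> * L * c / 2) * (gradient f x \<bullet> s x)"
proof -
  have "f (x - \<alpha> *\<^sub>R s x) \<le> f x + gradient f x \<bullet> (- \<alpha> *\<^sub>R s x) + L / 2 * (norm (- \<alpha> *\<^sub>R s x))\<^sup>2"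
    using smooth_upper_bound[OF assms(1,2), of x "- \<alpha> *\<^sub>R s x"] by simp
  also have "(norm (- \<alpha> *\<^sub>R s x))\<^sup>2 = \<alpha>\<^sup>2 * (c * (gradient f x \<bullet> s x))"
    using norm_sketch_mult[OF assms(3), of "gradient f x"] by (simp add: s_def power_mult_distrib)
  finally show ?thesis by (simp add: algebra_simps power2_eq_square)
qed

section \<open>Expectations of quadratic forms and almost sure convergence\<close>

text \<open>Expanding into entries turns the form into a finite sum of products of independent real
  variables, whose expectations factor. This replaces conditioning on the past.\<close>

lemma (in prob_space) expectation_indep_quadratic_form:
  fixes A :: "'a \<Rightarrow> real ^ 'd ^ 'd" and G :: "'a \<Rightarrow> real ^ 'd"
  assumes indep: "\<And>i j. indep_var borel (\<lambda>w. A w $ i $ j) borel (\<lambda>w. G w $ i * G w $ j)"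
    and A: "expectation A = mat 1"
    and G: "integrable M (\<lambda>w. (norm (G w))\<^sup>2)"
  shows "integrable M (\<lambda>w. G w \<bullet> (A w *v G w))"
    and "expectation (\<lambda>w. G w \<bullet> (A w *v G w)) = expectation (\<lambda>w. (norm (G w))\<^sup>2)"
proof -
  \<comment> \<open>The Bochner integral of a non-integrable function is 0 by convention, so a
    nonzero mean already forces integrability of \<open>A\<close>.\<close>
  have "(mat 1 :: real ^ 'd ^ 'd) \<noteq> 0"
    by (auto simp: vec_eq_iff mat_def)
  then have intA: "integrable M A"
    using A not_integrable_integral_eq[of M A] by fastforce
  have lin: "bounded_linear (\<lambda>B :: real ^ 'd ^ 'd. B $ i $ j)" for i j
    using bounded_linear_compose[OF bounded_linear_vec_nth[of j] bounded_linear_vec_nth[of i]] .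
  have intAij: "integrable M (\<lambda>w. A w $ i $ j)" for i j
    by (rule integrable_bounded_linear[OF lin intA])
  have EAij: "expectation (\<lambda>w. A w $ i $ j) = mat 1 $ i $ j" for i j
    using integral_bounded_linear[OF lin intA] A by simp
  have intGij: "integrable M (\<lambda>w. G w $ i * G w $ j)" for i j
  proof (rule Bochner_Integration.integrable_bound[OF G])
    show "(\<lambda>w. G w $ i * G w $ j) \<in> borel_measurable M"
      using indep by (rule indep_var_rv2)
    show "AE w in M. norm (G w $ i * G w $ j) \<le> norm ((norm (G w))\<^sup>2)"
    proof (intro AE_I2)
      fix w
      have "\<bar>G w $ i\<bar> * \<bar>G w $ j\<bar> \<le> norm (G w) * norm (G w)"
        by (intro mult_mono component_le_norm_cart) auto
      then show "norm (G w $ i * G w $ j) \<le> norm ((norm (G w))\<^sup>2)"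
        by (simp add: abs_mult power2_eq_square)
    qed
  qed
  have int: "integrable M (\<lambda>w. A w $ i $ j * (G w $ i * G w $ j))" for i j
    by (rule indep_var_integrable[OF indep intAij intGij])
  have E: "expectation (\<lambda>w. A w $ i $ j * (G w $ i * G w $ j))
      = mat 1 $ i $ j * expectation (\<lambda>w. G w $ i * G w $ j)" for i j
    using indep_var_lebesgue_integral[OF indep intAij intGij] EAij by simp
  have eq: "G w \<bullet> (A w *v G w) = (\<Sum>i\<in>UNIV. \<Sum>j\<in>UNIV. A w $ i $ j * (G w $ i * G w $ j))" for w
    by (simp add: inner_vec_def matrix_vector_mult_def sum_distrib_left mult_ac)
  show "integrable M (\<lambda>w. G w \<bullet> (A w *v G w))"
    unfolding eq by (intro Bochner_Integration.integrable_sum int)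
  have "expectation (\<lambda>w. G w \<bullet> (A w *v G w))
      = (\<Sum>i\<in>UNIV. \<Sum>j\<in>UNIV. mat 1 $ i $ j * expectation (\<lambda>w. G w $ i * G w $ j))"
    unfolding eq by (simp add: Bochner_Integration.integral_sum Bochner_Integration.integrable_sum int E)
  \<comment> \<open>The identity matrix keeps only the diagonal terms.\<close>
  also have "\<dots> = (\<Sum>i\<in>UNIV. expectation (\<lambda>w. G w $ i * G w $ i))"
    by (simp add: mat_def if_distrib[of "\<lambda>x. x * _"] cong: if_cong)
  also have "\<dots> = expectation (\<lambda>w. \<Sum>i\<in>UNIV. G w $ i * G w $ i)"
    by (simp add: Bochner_Integration.integral_sum intGij)
  also have "\<dots> = expectation (\<lambda>w. (norm (G w))\<^sup>2)"
    by (simp add: power2_norm_eq_inner inner_vec_def)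
  finally show "expectation (\<lambda>w. G w \<bullet> (A w *v G w)) = expectation (\<lambda>w. (norm (G w))\<^sup>2)" .
qed

text \<open>Monotone convergence bounds the integral of the whole series by \<open>C\<close>. The
  series is then almost everywhere finite, and the terms of a convergent series tend to 0.\<close>

lemma AE_tendsto_0_if_integral_sums_bounded:
  fixes h :: "nat \<Rightarrow> 'a \<Rightarrow> real"
  assumes int: "\<And>k. integrable M (h k)" and nn: "\<And>k x. 0 \<le> h k x"
    and bound: "\<And>n. (\<Sum>k<n. integral\<^sup>L M (h k)) \<le> C"
  shows "AE x in M. (\<lambda>k. h k x) \<longlonglongrightarrow> 0"
proof -
  have [measurable]: "h k \<in> borel_measurable M" for k
    using int by auto
  have "(\<integral>\<^sup>+ x. (\<Sum>k. ennreal (h k x)) \<partial>M) = (\<Sum>k. ennreal (integral\<^sup>L M (h k)))"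
    by (simp add: nn_integral_suminf nn_integral_eq_integral int nn)
  also have "\<dots> \<le> ennreal C"
    by (intro suminf_le_const summableI) (simp add: sum_ennreal nn integral_nonneg bound ennreal_leI)
  finally have "(\<integral>\<^sup>+ x. (\<Sum>k. ennreal (h k x)) \<partial>M) \<noteq> \<infinity>"
    by (auto simp: top_unique)
  moreover have "(\<lambda>x. \<Sum>k. ennreal (h k x)) \<in> borel_measurable M"
    by measurable
  ultimately have "AE x in M. (\<Sum>k. ennreal (h k x)) \<noteq> \<infinity>"
    by (intro nn_integral_PInf_AE)
  then show ?thesis
  proof eventually_elim
    case (elim x)
    then show ?case
      by (intro summable_LIMSEQ_zero summable_suminf_not_top) (auto simp: nn)
  qed
qed

section \<open>Dependence of the iterates on the matrices, and measurability\<close>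

lemma subspace_descent_cong:
  "(\<And>i. i < k \<Longrightarrow> P i = Q i) \<Longrightarrow> subspace_descent f \<alpha> P x0 k = subspace_descent f \<alpha> Q x0 k"
  by (induction k) auto

lemma measurable_sketch_step:
  fixes g :: "real ^ 'd \<Rightarrow> real ^ 'd"
  assumes "continuous_on UNIV g"
  shows "(\<lambda>(x, p :: real ^ 'l ^ 'd). x - \<alpha> *\<^sub>R ((p ** transpose p) *v g x)) \<in> borel_measurable borel"
proof (rule borel_measurable_continuous_onI)
  \<comment> \<open>Registers composition with \<open>g\<close>, so that joint continuity in point
    and matrix follows structurally.\<close>
  have [continuous_intros]: "continuous_on S (\<lambda>z. g (h z))"
    if "continuous_on S h" for S and h :: "(real ^ 'd) \<times> (real ^ 'l ^ 'd) \<Rightarrow> _"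
    using continuous_on_compose2[OF assms that] by auto
  show "continuous_on UNIV (\<lambda>(x, p :: real ^ 'l ^ 'd). x - \<alpha> *\<^sub>R ((p ** transpose p) *v g x))"
    unfolding case_prod_beta matrix_vector_mult_def matrix_matrix_mult_def transpose_def
    by (auto intro!: continuous_intros)
qed

text \<open>The source \<open>N\<close> is arbitrary because the result is applied both on the
  probability space and on the product space of the first \<open>k\<close> matrices, where only the
  coordinates below \<open>k\<close> are available.\<close>

lemma measurable_subspace_descent:
  fixes P :: "nat \<Rightarrow> 'b \<Rightarrow> real ^ 'l ^ 'd" and f :: "real ^ 'd \<Rightarrow> real"
  assumes cont: "continuous_on UNIV (gradient f)"
    and P: "\<And>i. i < k \<Longrightarrow> P i \<in> borel_measurable N"
  shows "(\<lambda>w. subspace_descent f \<alpha> (\<lambda>i. P i w) x0 k) \<in> borel_measurable N"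
  using P
proof (induction k)
  case (Suc k)
  then have "(\<lambda>w. (subspace_descent f \<alpha> (\<lambda>i. P i w) x0 k, P k w)) \<in> borel_measurable N"
    by (intro borel_measurable_Pair) auto
  from measurable_compose[OF this measurable_sketch_step[OF cont]] show ?case
    by simp
qed simp

section \<open>The random iterates for a fixed step size\<close>

text \<open>The condition \<open>step_lt\<close> is what makes the decrease constant
  \<open>\<eta>\<close> positive. With \<open>c\<close> equal to d/l it covers the step sizes of
  both claims.\<close>

locale random_subspace_descent = prob_space M
  for M :: "'w measure" +
  fixes P :: "nat \<Rightarrow> 'w \<Rightarrow> real ^ 'l::finite ^ 'd::finite"
    and f :: "real ^ 'd \<Rightarrow> real"
    and L m c \<alpha> :: real
    and x0 :: "real ^ 'd"
  assumes indep: "indep_vars (\<lambda>_. borel) P UNIV"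
    and mean: "\<And>k. expectation (\<lambda>w. P k w ** transpose (P k w)) = mat 1"
    and orth: "\<And>k. AE w in M. transpose (P k w) ** P k w = c *\<^sub>R mat 1"
    and diff: "\<And>x. f differentiable (at x)"
    and L_pos: "L > 0"
    and lips: "L-lipschitz_on UNIV (gradient f)"
    and minimum: "\<And>x. m \<le> f x"
    and step_pos: "\<alpha> > 0"
    and step_lt: "\<alpha> * L * c < 2"
begin

definition X :: "nat \<Rightarrow> 'w \<Rightarrow> real ^ 'd" where
  "X k w = subspace_descent f \<alpha> (\<lambda>i. P i w) x0 k"

definition G :: "nat \<Rightarrow> 'w \<Rightarrow> real ^ 'd" where
  "G k w = gradient f (X k w)"

definition A :: "nat \<Rightarrow> 'w \<Rightarrow> real ^ 'd ^ 'd" where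
  "A k w = P k w ** transpose (P k w)"

definition \<eta> :: real where
  "\<eta> = \<alpha> * (1 - \<alpha> * L * c / 2)"

lemma eta_pos: "\<eta> > 0"
  using step_pos step_lt by (simp add: \<eta>_def)

lemma continuous_gradient: "continuous_on UNIV (gradient f)"
  using lips by (rule lipschitz_on_continuous_on)

lemma measurable_P [measurable]: "P k \<in> borel_measurable M"
  using indep by (auto simp: indep_vars_def)

lemma measurable_X [measurable]: "X k \<in> borel_measurable M"
  unfolding X_def by (rule measurable_subspace_descent[OF continuous_gradient]) simp

lemma measurable_G [measurable]: "G k \<in> borel_measurable M"
  unfolding G_def by (rule borel_measurable_continuous_on[OF continuous_gradient]) simp

lemma measurable_f_X [measurable]: "(\<lambda>w. f (X k w)) \<in> borel_measurable M"
proof (rule borel_measurable_continuous_on[of f])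
  show "continuous_on UNIV f"
    using diff by (intro differentiable_imp_continuous_on) (simp add: differentiable_on_def)
qed simp

lemma AE_step_le: "AE w in M. f (X (Suc k) w) \<le> f (X k w) - \<eta> * (G k w \<bullet> (A k w *v G k w))"
  using orth[of k]
proof eventually_elim
  case (elim w)
  from sketched_step_le[OF diff lips elim, of "X k w" \<alpha>] show ?case
    by (simp add: X_def G_def A_def \<eta>_def)
qed

lemma AE_f_X_le: "AE w in M. f (X k w) \<le> f x0"
proof (induction k)
  case 0
  show ?case by (simp add: X_def)
next
  case (Suc k)
  with AE_step_le[of k] show ?case
  proof eventually_elim
    case (elim w)
    have "0 \<le> \<eta> * (G k w \<bullet> (A k w *v G k w))"
      using eta_pos by (simp add: A_def sketch_quadratic)
    with elim show ?case by linarith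
  qed
qed

text \<open>Almost surely the values lie between \<open>m\<close> and \<open>f x0\<close>, because
  no step increases \<open>f\<close>.\<close>

lemma integrable_f_X: "integrable M (\<lambda>w. f (X k w))"
proof (rule integrable_const_bound[where B = "\<bar>f x0\<bar> + \<bar>m\<bar>"])
  show "AE w in M. norm (f (X k w)) \<le> \<bar>f x0\<bar> + \<bar>m\<bar>"
    using AE_f_X_le[of k]
  proof eventually_elim
    case (elim w)
    with minimum[of "X k w"] show ?case by (simp add: abs_if split: if_splits)
  qed
qed simp

lemma integrable_norm_G: "integrable M (\<lambda>w. (norm (G k w))\<^sup>2)"
proof (rule Bochner_Integration.integrable_bound)
  show "integrable M (\<lambda>w. 2 * L * (f (X k w) - m))"
    using integrable_f_X[of k] by simp
  show "AE w in M. norm ((norm (G k w))\<^sup>2) \<le> norm (2 * L * (f (X k w) - m))"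
    using norm_gradient_le[OF diff lips L_pos minimum]
    by (auto simp: G_def intro!: AE_I2 order_trans[OF _ abs_ge_self])
qed simp

text \<open>The current matrix uses coordinate \<open>k\<close> of the sequence and the current
  gradient only the coordinates below \<open>k\<close>; functions of disjoint blocks of an
  independent family are independent.\<close>

lemma indep_A_G: "indep_var borel (\<lambda>w. A k w $ i $ j) borel (\<lambda>w. G k w $ i * G k w $ j)"
proof -
  let ?A = "\<lambda>Q :: nat \<Rightarrow> real ^ 'l ^ 'd. (Q k ** transpose (Q k)) $ i $ j"
  let ?x = "\<lambda>Q :: nat \<Rightarrow> real ^ 'l ^ 'd. subspace_descent f \<alpha> Q x0 k"
  let ?G = "\<lambda>Q. gradient f (?x Q) $ i * gradient f (?x Q) $ j"
  have "continuous_on UNIV (\<lambda>x. gradient f x $ i * gradient f x $ j)"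
    by (intro continuous_intros continuous_gradient)
  then have G: "?G \<in> borel_measurable (Pi\<^sub>M {..<k} (\<lambda>_. borel))"
    by (rule borel_measurable_continuous_on)
      (intro measurable_subspace_descent[OF continuous_gradient], simp)
  have "continuous_on UNIV (\<lambda>p :: real ^ 'l ^ 'd. (p ** transpose p) $ i $ j)"
    unfolding matrix_matrix_mult_def transpose_def by (auto intro!: continuous_intros)
  then have A: "?A \<in> borel_measurable (Pi\<^sub>M {k} (\<lambda>_. borel))"
    by (rule borel_measurable_continuous_on[of "\<lambda>p. (p ** transpose p) $ i $ j" "\<lambda>Q. Q k"]) simp
  have "indep_var borel (?A \<circ> (\<lambda>w. restrict (\<lambda>i. P i w) {k}))
      borel (?G \<circ> (\<lambda>w. restrict (\<lambda>i. P i w) {..<k}))"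
    by (rule indep_var_compose[OF indep_var_restrict[OF indep] A G]) auto
  \<comment> \<open>Restriction alters only entries from \<open>k\<close> onwards, which iterate
    \<open>k\<close> never reads.\<close>
  moreover have "?x (restrict (\<lambda>i. P i w) {..<k}) = X k w" for w
    unfolding X_def by (rule subspace_descent_cong) simp
  ultimately show ?thesis
    by (simp add: comp_def A_def G_def)
qed

section \<open>Expected decrease, convergence and linear rate\<close>

lemma expectation_step_le:
  "expectation (\<lambda>w. f (X (Suc k) w))
    \<le> expectation (\<lambda>w. f (X k w)) - \<eta> * expectation (\<lambda>w. (norm (G k w))\<^sup>2)"
proof -
  have EA: "expectation (A k) = mat 1"
    using mean[of k] unfolding A_def[abs_def] .
  note q = expectation_indep_quadratic_form[OF indep_A_G EA integrable_norm_G]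
  have "expectation (\<lambda>w. f (X (Suc k) w))
      \<le> expectation (\<lambda>w. f (X k w) - \<eta> * (G k w \<bullet> (A k w *v G k w)))"
    using q(1) by (intro integral_mono_AE AE_step_le Bochner_Integration.integrable_diff
        integrable_f_X integrable_mult_right)
  also have "\<dots> = expectation (\<lambda>w. f (X k w)) - \<eta> * expectation (\<lambda>w. (norm (G k w))\<^sup>2)"
    using q integrable_f_X[of k] by simp
  finally show ?thesis .
qed

lemma expectation_f_X_ge: "m \<le> expectation (\<lambda>w. f (X k w))"
  using integral_mono[OF _ integrable_f_X[of k], of "\<lambda>_. m"] minimum by (simp add: prob_space)

lemma expectation_f_X_0: "expectation (\<lambda>w. f (X 0 w)) = f x0"
  by (simp add: X_def prob_space)

text \<open>The expected decreases telescope, and the total decrease is at most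
  \<open>f x0 - m\<close>.\<close>

lemma AE_gradient_tendsto_0: "AE w in M. (\<lambda>k. (norm (G k w))\<^sup>2) \<longlonglongrightarrow> 0"
proof (rule AE_tendsto_0_if_integral_sums_bounded[OF integrable_norm_G])
  fix n
  have "\<eta> * (\<Sum>k<n. expectation (\<lambda>w. (norm (G k w))\<^sup>2)) \<le> f x0 - expectation (\<lambda>w. f (X n w))"
  proof (induction n)
    case 0
    show ?case by (simp add: expectation_f_X_0)
  next
    case (Suc n)
    with expectation_step_le[of n] show ?case by (simp add: distrib_left)
  qed
  also have "\<dots> \<le> f x0 - m"
    using expectation_f_X_ge[of n] by simp
  finally show "(\<Sum>k<n. expectation (\<lambda>w. (norm (G k w))\<^sup>2)) \<le> (f x0 - m) / \<eta>"
    using eta_pos by (simp add: field_simps)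
qed simp

text \<open>The Polyak-Lojasiewicz inequality bounds the expected squared gradient norm below by
  \<open>2 * \<gamma>\<close> times the expected gap, so each step contracts the gap.\<close>

lemma linear_rate:
  assumes PL: "polyak_lojasiewicz \<gamma> f m" and "\<gamma> > 0"
  shows "expectation (\<lambda>w. f (X k w)) - m \<le> (1 - 2 * \<eta> * \<gamma>) ^ k * (f x0 - m)"
proof -
  define a where "a k = expectation (\<lambda>w. f (X k w)) - m" for k
  define q where "q = 1 - 2 * \<eta> * \<gamma>"
  have a_nonneg: "0 \<le> a k" for k
    using expectation_f_X_ge by (simp add: a_def)
  have step: "a (Suc k) \<le> q * a k" for k
  proof -
    have "2 * \<gamma> * a k = expectation (\<lambda>w. 2 * \<gamma> * (f (X k w) - m))"
      using integrable_f_X[of k] by (simp add: a_def prob_space)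
    also have "\<dots> \<le> expectation (\<lambda>w. (norm (G k w))\<^sup>2)"
    proof (rule integral_mono[OF _ integrable_norm_G])
      show "integrable M (\<lambda>w. 2 * \<gamma> * (f (X k w) - m))"
        using integrable_f_X[of k] by simp
      show "2 * \<gamma> * (f (X k w) - m) \<le> (norm (G k w))\<^sup>2" for w
        using PL[unfolded polyak_lojasiewicz_def, rule_format, of "X k w"] \<open>\<gamma> > 0\<close>
        by (simp add: G_def field_simps)
    qed
    finally have "\<eta> * (2 * \<gamma> * a k) \<le> \<eta> * expectation (\<lambda>w. (norm (G k w))\<^sup>2)"
      using eta_pos by simp
    with expectation_step_le[of k] show ?thesis
      by (simp add: a_def q_def algebra_simps)
  qed
  have "a k \<le> q ^ k * a 0"
  \<comment> \<open>Iterating \<open>step\<close> multiplies an inequality by \<open>q\<close>, so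
    the sign of \<open>q\<close> matters.\<close>
  proof (cases "q \<ge> 0")
    case True
    show ?thesis
    proof (induction k)
      case (Suc k)
      have "a (Suc k) \<le> q * a k" by (rule step)
      also have "\<dots> \<le> q * (q ^ k * a 0)"
        using Suc True by (rule mult_left_mono)
      finally show ?case by simp
    qed simp
  next
    case False
    \<comment> \<open>A negative rate is compatible with \<open>a \<ge> 0\<close> only if the process starts at the minimum.\<close>
    have "a k = 0" for k
    proof (rule ccontr)
      assume "a k \<noteq> 0"
      with a_nonneg[of k] False have "q * a k < 0" by (simp add: mult_neg_pos)
      with step[of k] a_nonneg[of "Suc k"] show False by linarith
    qed
    then show ?thesis by simp
  qed
  then show ?thesis by (simp add: a_def q_def expectation_f_X_0)
qed

lemma AE_tendsto_minimizer:
  assumes sc: "strongly_convex \<gamma> f" and "\<gamma> > 0" and z: "f z = m"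
  shows "AE w in M. (\<lambda>k. X k w) \<longlonglongrightarrow> z"
  using AE_gradient_tendsto_0
proof eventually_elim
  case (elim w)
  have "gradient f z = 0"
    using norm_gradient_le[OF diff lips L_pos minimum, of z] z by simp
  note growth = strongly_convex_growth[OF sc this]
  have PL: "polyak_lojasiewicz \<gamma> f m"
    using strongly_convex_imp_polyak_lojasiewicz[OF sc \<open>\<gamma> > 0\<close> rangeI[of f z]] z by simp
  \<comment> \<open>Quadratic growth bounds the distance by the function gap, and Polyak-Lojasiewicz
    bounds the gap by the gradient; the factors combine to distance at most gradient norm over
    \<open>\<gamma>\<close>.\<close>
  have le: "(norm (X k w - z))\<^sup>2 \<le> (norm (G k w))\<^sup>2 * (1 / \<gamma>\<^sup>2)" for k
  proof -
    have "\<gamma> / 2 * (norm (X k w - z))\<^sup>2 \<le> (norm (G k w))\<^sup>2 / (2 * \<gamma>)"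
      using growth[of "X k w"] PL[unfolded polyak_lojasiewicz_def, rule_format, of "X k w"] z
      unfolding G_def by linarith
    then show ?thesis
      using \<open>\<gamma> > 0\<close> by (simp add: field_simps power2_eq_square)
  qed
  have "(\<lambda>k. (norm (X k w - z))\<^sup>2) \<longlonglongrightarrow> 0"
  proof (rule tendsto_sandwich[OF _ _ tendsto_const])
    show "(\<lambda>k. (norm (G k w))\<^sup>2 * (1 / \<gamma>\<^sup>2)) \<longlonglongrightarrow> 0"
      using tendsto_mult_right[OF elim, of "1 / \<gamma>\<^sup>2"] by simp
    show "\<forall>\<^sub>F k in sequentially. (norm (X k w - z))\<^sup>2 \<le> (norm (G k w))\<^sup>2 * (1 / \<gamma>\<^sup>2)"
      using le by (intro always_eventually allI)
  qed simp
  from tendsto_real_sqrt[OF this] have "(\<lambda>k. norm (X k w - z)) \<longlonglongrightarrow> 0"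
    by simp
  then show ?case
    by (rule LIM_zero_cancel[OF tendsto_norm_zero_cancel])
qed

end

text \<open>Uniqueness of the minimizer is expressed by a singleton set of minimizers. Integrability
  accompanies the rate because otherwise the integral could be the default value 0.\<close>

theorem corollary1:
  fixes M :: "'w measure"
    and P :: "nat \<Rightarrow> 'w \<Rightarrow> real ^ 'l::finite ^ 'd::finite"
    and f :: "real ^ 'd \<Rightarrow> real"
    and lam fmin :: real
    and x0 :: "real ^ 'd"
  assumes "prob_space M"
    and "CARD('l) \<le> CARD('d)"
    and indep: "prob_space.indep_vars M (\<lambda>_. borel) P UNIV"
    and ident: "\<And>k. distr M borel (P k) = distr M borel (P 0)"
    and mean: "\<And>k. (LINT w|M. P k w ** transpose (P k w)) = mat 1"
    and orth: "\<And>k. AE w in M. transpose (P k w) ** P k w = (real CARD('d) / real CARD('l)) *\<^sub>R mat 1"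
    and diff: "\<And>x. f differentiable (at x)"
    and cont: "continuous_on UNIV (gradient f)"
    and "lam > 0"
    and lips: "lam-lipschitz_on UNIV (gradient f)"
    and attained: "fmin \<in> range f"
    and minimum: "\<And>x. fmin \<le> f x"
  shows "(\<forall>\<gamma> \<alpha>. 0 < \<gamma> \<longrightarrow> strongly_convex \<gamma> f \<longrightarrow>
            0 < \<alpha> \<longrightarrow> \<alpha> < 2 * real CARD('l) / (real CARD('d) * lam) \<longrightarrow>
            (\<exists>xmin. {x. is_arg_min f (\<lambda>_. True) x} = {xmin} \<and>
               (AE w in M. (\<lambda>k. subspace_descent f \<alpha> (\<lambda>i. P i w) x0 k) \<longlonglongrightarrow> xmin)))
       \<and> (\<forall>\<gamma> \<alpha>. (0 < \<gamma> \<and> \<gamma> \<le> lam \<and> polyak_lojasiewicz \<gamma> f fmin) \<or> (0 < \<gamma> \<and> strongly_convex \<gamma> f) \<longrightarrow>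
            \<alpha> = real CARD('l) / (real CARD('d) * lam) \<longrightarrow>
            (\<forall>k. integrable M (\<lambda>w. f (subspace_descent f \<alpha> (\<lambda>i. P i w) x0 k)) \<and>
               (LINT w|M. f (subspace_descent f \<alpha> (\<lambda>i. P i w) x0 k)) - fmin
                 \<le> (1 - real CARD('l) * \<gamma> / (real CARD('d) * lam)) ^ k * (f x0 - fmin)))"
proof -
  define c where "c = real CARD('d) / real CARD('l)"
  interpret prob_space M by fact
  have process: "random_subspace_descent M P f lam fmin c \<alpha>"
    if "0 < \<alpha>" "\<alpha> * lam * c < 2" for \<alpha>
    using that indep mean orth diff \<open>lam > 0\<close> lips minimum
    by unfold_locales (auto simp: c_def)
  obtain z where z: "f z = fmin" using attained by auto
  show ?thesis
  proof (intro conjI allI impI)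
    fix \<gamma> \<alpha> :: real
    assume "0 < \<gamma>" and sc: "strongly_convex \<gamma> f" and \<alpha>: "0 < \<alpha>"
      "\<alpha> < 2 * real CARD('l) / (real CARD('d) * lam)"
    \<comment> \<open>The upper limit on \<open>\<alpha>\<close> is exactly
      \<open>2 / (lam * c)\<close>.\<close>
    have "\<alpha> * lam * c < 2"
      using \<alpha> \<open>lam > 0\<close> by (simp add: c_def field_simps)
    then interpret random_subspace_descent M P f lam fmin c \<alpha> x0
      using \<alpha> by (intro process)
    have "gradient f z = 0"
      using norm_gradient_le[OF diff lips \<open>lam > 0\<close> minimum, of z] z by simp
    from strongly_convex_growth[OF sc this] have "x = z" if "f x = fmin" for x
      using that z \<open>0 < \<gamma>\<close> by (smt (verit) divide_pos_pos mult_pos_pos norm_eq_zero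
          right_minus_eq zero_less_power2)
    moreover have "is_arg_min f (\<lambda>_. True) x \<longleftrightarrow> f x = fmin" for x
      using minimum[of x] minimum z unfolding is_arg_min_linorder by (metis order_antisym)
    ultimately have "{x. is_arg_min f (\<lambda>_. True) x} = {z}"
      using z by blast
    moreover have "AE w in M. (\<lambda>k. subspace_descent f \<alpha> (\<lambda>i. P i w) x0 k) \<longlonglongrightarrow> z"
      using AE_tendsto_minimizer[OF sc \<open>0 < \<gamma>\<close> z] by (simp add: X_def)
    ultimately show "\<exists>xmin. {x. is_arg_min f (\<lambda>_. True) x} = {xmin} \<and>
        (AE w in M. (\<lambda>k. subspace_descent f \<alpha> (\<lambda>i. P i w) x0 k) \<longlonglongrightarrow> xmin)"
      by blast
  next
    fix \<gamma> \<alpha> :: real and k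
    assume \<gamma>: "(0 < \<gamma> \<and> \<gamma> \<le> lam \<and> polyak_lojasiewicz \<gamma> f fmin) \<or> (0 < \<gamma> \<and> strongly_convex \<gamma> f)"
      and \<alpha>: "\<alpha> = real CARD('l) / (real CARD('d) * lam)"
    \<comment> \<open>With this product equal to 1, \<open>\<eta>\<close> is
      \<open>\<alpha> / 2\<close>, so the factor \<open>1 - 2 * \<eta> * \<gamma>\<close> becomes
      \<open>1 - \<alpha> * \<gamma>\<close>, the claimed rate.\<close>
    have "0 < \<alpha>" and \<alpha>1: "\<alpha> * lam * c = 1"
      using \<alpha> \<open>lam > 0\<close> by (simp_all add: c_def)
    then interpret random_subspace_descent M P f lam fmin c \<alpha> x0
      by (intro process) auto
    have "polyak_lojasiewicz \<gamma> f fmin" "0 < \<gamma>"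
      using \<gamma> strongly_convex_imp_polyak_lojasiewicz attained by auto
    from linear_rate[OF this, of k]
    show "(LINT w|M. f (subspace_descent f \<alpha> (\<lambda>i. P i w) x0 k)) - fmin
        \<le> (1 - real CARD('l) * \<gamma> / (real CARD('d) * lam)) ^ k * (f x0 - fmin)"
      unfolding X_def \<eta>_def \<alpha>1 by (simp add: \<alpha>)
    show "integrable M (\<lambda>w. f (subspace_descent f \<alpha> (\<lambda>i. P i w) x0 k))"
      using integrable_f_X[of k] by (simp add: X_def)
  qed
qed

end
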